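(* Let $\mathcal{U}$ be a finite set of UEs and $\mathcal{A}$ a finite set of APs, with sets $\mathcal{U}_k\subseteq\mathcal{A}$ ($k\in\mathcal{U}$) and $\mathcal{A}_m\subseteq\mathcal{U}$ ($m\in\mathcal{A}$) as defined in the context. Consider the following two problems. (P) Pilot length minimization: minimize $\tau_p$ over all positive integers $\tau_p$, all sets of orthonormal pilot sequences $\{\boldsymbol{\varphi}_1,\dots,\boldsymbol{\varphi}_{\tau_p}\}\subset\mathbb{C}^{\tau_p}$ and all pilot assignments $l:\mathcal{U}\to\{1,\dots,\tau_p\}$, subject to $\langle\boldsymbol{\varphi}_{l(k)},\boldsymbol{\varphi}_{l(k')}\rangle=0$ for all $k\in\mathcal{U}$, all $m\in\mathcal{U}_k$ and all $k'\in\mathcal{A}_m$ with $k'\ne k$. (C) Vertex coloring: let $\mathcal{G}=(\mathcal{V},\mathcal{E})$ be the graph with vertex set $\mathcal{V}=\mathcal{U}$, in which distinct $k,k'\in\mathcal{U}$ are joined by an edge $e_{kk'}\in\mathcal{E}$ if and only if $\mathcal{U}_k\cap\mathcal{U}_{k'}\neq\emptyset$. Minimize the number $|\mathcal{C}|$ of colors over all color sets $\mathcal{C}$ and all colorings $k\mapsto\mathcal{C}(k)\in\mathcal{C}$ of the vertices, subject to $\mathcal{C}(k)\neq\mathcal{C}(k')$ whenever $e_{kk'}\in\mathcal{E}$. Then (P) and (C) are equivalent: identifying colors with pilot sequences, an assignment $l$ is feasible for (P) if and only if it is a feasible coloring for (C), and the two problems have the same optimal value.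
   Context: UE $k$ is located at $\mathbf{u}_k$ and AP $m$ at $\mathbf{a}_m$ (points of the plane), and $d_{mk}=\|\mathbf{u}_k-\mathbf{a}_m\|$. The clusters are $$\mathcal{U}_k=\{m\in\mathcal{A}:\|\mathbf{u}_k-\mathbf{a}_m\|\le r_{\mathsf o}\},\qquad \mathcal{A}_m=\{k\in\mathcal{U}:\|\mathbf{u}_k-\mathbf{a}_m\|\le r_{\mathsf o}\}.$$ The radius is $r_{\mathsf o}=\max\{\max_{k\in\mathcal{U}}\min_{m\in\mathcal{A}}d_{mk},\ d_{\mathsf{SNR}_{\mathsf o}}\}$, where $d_{\mathsf{SNR}_{\mathsf o}}$ is the largest distance $d$ with $N\mathcal{E}_p\beta(d)/N_0\ge\gamma_{\min}$. Here $\beta(d)=(d/d_0)^{-\mathrm{PL}}$, and $N,\mathcal{E}_p,N_0,\gamma_{\min},d_0,\mathrm{PL}>0$ are given constants. Since the pilots are orthonormal, $\langle\boldsymbol{\varphi}_{i},\boldsymbol{\varphi}_{j}\rangle$ equals $1$ if $i=j$ and $0$ otherwise. *)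

theory Defs
  imports "HOL-Analysis.Analysis" "Jordan_Normal_Form.Conjugate" "Jordan_Normal_Form.Matrix"
begin

definition path_gain :: "real \<Rightarrow> real \<Rightarrow> real \<Rightarrow> real" where
  "path_gain d0 PL d = (d / d0) powr (- PL)"

text \<open>The restriction to \<open>0 < d\<close> keeps to the range where \<open>powr\<close> is the real power; \<open>snr_distance_greatest\<close>
  below shows that the largest such distance exists.\<close>

definition snr_distance :: "real \<Rightarrow> real \<Rightarrow> real \<Rightarrow> real \<Rightarrow> real \<Rightarrow> real \<Rightarrow> real" where
  "snr_distance N Ep N0 gmin d0 PL =
     (GREATEST d. 0 < d \<and> N * Ep * path_gain d0 PL d / N0 \<ge> gmin)"

definition cluster_radius ::
  "'u set \<Rightarrow> 'a set \<Rightarrow> ('u \<Rightarrow> real^2) \<Rightarrow> ('a \<Rightarrow> real^2) \<Rightarrow> real \<Rightarrow> real" where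
  "cluster_radius U A u a dsnr =
     max (Max ((\<lambda>k. Min ((\<lambda>m. norm (u k - a m)) ` A)) ` U)) dsnr"

definition ue_cluster ::
  "'a set \<Rightarrow> ('u \<Rightarrow> real^2) \<Rightarrow> ('a \<Rightarrow> real^2) \<Rightarrow> real \<Rightarrow> 'u \<Rightarrow> 'a set" where
  "ue_cluster A u a r k = {m \<in> A. norm (u k - a m) \<le> r}"

definition ap_cluster ::
  "'u set \<Rightarrow> ('u \<Rightarrow> real^2) \<Rightarrow> ('a \<Rightarrow> real^2) \<Rightarrow> real \<Rightarrow> 'a \<Rightarrow> 'u set" where
  "ap_cluster U u a r m = {k \<in> U. norm (u k - a m) \<le> r}"

definition orthonormal_pilots :: "nat \<Rightarrow> (nat \<Rightarrow> complex Matrix.vec) \<Rightarrow> bool" where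
  "orthonormal_pilots \<tau> \<phi> \<longleftrightarrow>
     (\<forall>i\<in>{1..\<tau>}. \<phi> i \<in> carrier_vec \<tau>) \<and>
     (\<forall>i\<in>{1..\<tau>}. \<forall>j\<in>{1..\<tau>}. \<phi> i \<bullet>c \<phi> j = (if i = j then 1 else 0))"

definition pilot_feasible ::
  "'u set \<Rightarrow> ('u \<Rightarrow> 'a set) \<Rightarrow> ('a \<Rightarrow> 'u set) \<Rightarrow>
   nat \<Rightarrow> (nat \<Rightarrow> complex Matrix.vec) \<Rightarrow> ('u \<Rightarrow> nat) \<Rightarrow> bool" where
  "pilot_feasible U Uc Ac \<tau> \<phi> l \<longleftrightarrow>
     0 < \<tau> \<and> orthonormal_pilots \<tau> \<phi> \<and> l \<in> U \<rightarrow> {1..\<tau>} \<and>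
     (\<forall>k\<in>U. \<forall>m\<in>Uc k. \<forall>k'\<in>Ac m. k' \<noteq> k \<longrightarrow> \<phi> (l k) \<bullet>c \<phi> (l k') = 0)"

definition conflict_edges :: "'u set \<Rightarrow> ('u \<Rightarrow> 'a set) \<Rightarrow> 'u set set" where
  "conflict_edges U Uc =
     {{k, k'} | k k'. k \<in> U \<and> k' \<in> U \<and> k \<noteq> k' \<and> Uc k \<inter> Uc k' \<noteq> {}}"

text \<open>Finiteness of \<open>C\<close> makes \<open>card C\<close> the number of colors; colors in \<open>C\<close> may remain unused.\<close>

definition coloring_feasible :: "'u set \<Rightarrow> 'u set set \<Rightarrow> 'c set \<Rightarrow> ('u \<Rightarrow> 'c) \<Rightarrow> bool" where
  "coloring_feasible V E C c \<longleftrightarrow>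
     finite C \<and> c \<in> V \<rightarrow> C \<and> (\<forall>k\<in>V. \<forall>k'\<in>V. {k, k'} \<in> E \<longrightarrow> c k \<noteq> c k')"

lemma snr_distance_greatest:
  fixes N Ep N0 gmin d0 PL :: real
  assumes pos: "N > 0" "Ep > 0" "N0 > 0" "gmin > 0" "d0 > 0" "PL > 0"
  defines "D \<equiv> snr_distance N Ep N0 gmin d0 PL"
  shows "0 < D \<and> N * Ep * path_gain d0 PL D / N0 \<ge> gmin"
    and "\<And>d. 0 < d \<Longrightarrow> N * Ep * path_gain d0 PL d / N0 \<ge> gmin \<Longrightarrow> d \<le> D"
proof -
  define q where "q = N * Ep / (N0 * gmin)"
  have q: "q > 0" using pos by (simp add: q_def)
  define x where "x = d0 * q powr (1 / PL)"
  have x: "x > 0" using pos q by (simp add: x_def)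
  have iff: "N * Ep * path_gain d0 PL d / N0 \<ge> gmin \<longleftrightarrow> d \<le> x" if d: "0 < d" for d
  proof -
    have "N * Ep * path_gain d0 PL d / N0 \<ge> gmin \<longleftrightarrow> (d / d0) powr PL \<le> q"
      using pos d by (simp add: path_gain_def q_def powr_minus field_simps)
    also have "q = (q powr (1 / PL)) powr PL"
      using pos q by (simp add: powr_powr)
    also have "(d / d0) powr PL \<le> (q powr (1 / PL)) powr PL \<longleftrightarrow> d / d0 \<le> q powr (1 / PL)"
      using pos d q by (meson divide_pos_pos less_eq_real_def linorder_not_le powr_ge_zero
        powr_less_mono2 powr_mono2)
    also have "\<dots> \<longleftrightarrow> d \<le> x" using pos by (simp add: x_def field_simps)
    finally show ?thesis .
  qed
  have "D = x" unfolding D_def snr_distance_def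
    by (rule Greatest_equality) (use iff x in auto)
  then show "0 < D \<and> N * Ep * path_gain d0 PL D / N0 \<ge> gmin"
    and "\<And>d. 0 < d \<Longrightarrow> N * Ep * path_gain d0 PL d / N0 \<ge> gmin \<Longrightarrow> d \<le> D"
    using iff x by auto
qed

end

theory Submission
  imports Defs
begin

text \<open>The two kinds of clusters are dual: UE \<open>k'\<close> lies in the cluster of AP \<open>m\<close> iff \<open>m\<close> lies in the
  cluster of \<open>k'\<close>. Hence the constraint of the pilot problem ranges exactly over the edges of the
  conflict graph, and orthonormality turns it into \<open>l k \<noteq> l k'\<close>. The standard basis provides
  orthonormal pilots of every length, so pilot lengths and numbers of colors range over the same set.\<close>

lemma doubleton_in_conflict_edges_iff:
  "{k, k'} \<in> conflict_edges U Uc \<longleftrightarrow> k \<in> U \<and> k' \<in> U \<and> k \<noteq> k' \<and> Uc k \<inter> Uc k' \<noteq> {}"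
  unfolding conflict_edges_def by (auto simp: doubleton_eq_iff)

text \<open>Equal pilots with distinct indices would have an inner product that is both 1 and 0.
  Hence the pilots themselves can serve as colors.\<close>

lemma orthonormal_pilots_inj_on:
  assumes "orthonormal_pilots \<tau> \<phi>"
  shows "inj_on \<phi> {1..\<tau>}"
  using assms unfolding orthonormal_pilots_def inj_on_def by (metis zero_neq_one)

lemma orthonormal_pilots_unit_vec: "orthonormal_pilots \<tau> (\<lambda>i. unit_vec \<tau> (i - 1))"
proof -
  have "unit_vec \<tau> (i - 1) \<bullet>c unit_vec \<tau> (j - 1) = (if i = j then 1 else (0::complex))"
    if "i \<in> {1..\<tau>}" "j \<in> {1..\<tau>}" for i j
  proof -
    have "conjugate (unit_vec \<tau> (j - 1)) = (unit_vec \<tau> (j - 1) :: complex Matrix.vec)"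
      by (rule eq_vecI) (auto simp: unit_vec_def)
    \<comment> \<open>Coordinates of \<open>unit_vec\<close> count from 0, pilots from 1; the
      truncated \<open>i - 1\<close> is injective here because the indices are positive.\<close>
    moreover have "i - 1 < \<tau>" "j - 1 < \<tau>" "i - 1 = j - 1 \<longleftrightarrow> i = j" using that by auto
    ultimately show ?thesis by (auto simp: scalar_prod_left_unit)
  qed
  then show ?thesis unfolding orthonormal_pilots_def by simp
qed

text \<open>An injective relabelling keeps distinct colors distinct. The range of \<open>c\<close>
  is assumed since membership of \<open>f (c k)\<close> in the image of \<open>C\<close> does not by
  itself put \<open>c k\<close> in \<open>C\<close>.\<close>

lemma coloring_feasible_inj_image_iff:
  assumes "inj_on f C" "finite C" "c \<in> V \<rightarrow> C"
  shows "coloring_feasible V E (f ` C) (\<lambda>k. f (c k)) \<longleftrightarrow> coloring_feasible V E C c"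
proof -
  have "f (c k) = f (c k') \<longleftrightarrow> c k = c k'" if "k \<in> V" "k' \<in> V" for k k'
    using assms that by (metis PiE inj_on_eq_iff)
  moreover have "(\<lambda>k. f (c k)) \<in> V \<rightarrow> f ` C" using assms(3) by auto
  ultimately show ?thesis using assms unfolding coloring_feasible_def by simp
qed

text \<open>Only the number of colors matters: a bijection of color sets transports the coloring,
  even to another type.\<close>

lemma coloring_feasible_change_colors:
  assumes "coloring_feasible V E C c" "finite D" "card D = card C"
  shows "\<exists>d. coloring_feasible V E D d"
proof -
  have "finite C" using assms(1) by (simp add: coloring_feasible_def)
  then obtain f where "bij_betw f C D" using assms finite_same_card_bij by metis
  then show ?thesis
    using coloring_feasible_inj_image_iff[of f C c V E] assms(1)
    by (auto simp: bij_betw_def coloring_feasible_def)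
qed

text \<open>Edges join distinct vertices, so each vertex may be its own color; this supplies a
  feasible point.\<close>

lemma coloring_feasible_conflict_edges_id:
  assumes "finite U"
  shows "coloring_feasible U (conflict_edges U Uc) U (\<lambda>k. k)"
  using assms unfolding coloring_feasible_def by (auto simp: doubleton_in_conflict_edges_iff)

lemma pilot_feasible_iff_coloring_feasible:
  fixes U A u a r
  defines "Uc \<equiv> ue_cluster A u a r" and "Ac \<equiv> ap_cluster U u a r"
  shows "pilot_feasible U Uc Ac \<tau> \<phi> l \<longleftrightarrow>
    0 < \<tau> \<and> orthonormal_pilots \<tau> \<phi> \<and> coloring_feasible U (conflict_edges U Uc) {1..\<tau>} l"
proof -
  have orth: "\<phi> (l k) \<bullet>c \<phi> (l k') = 0 \<longleftrightarrow> l k \<noteq> l k'"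
    if "orthonormal_pilots \<tau> \<phi>" "l \<in> U \<rightarrow> {1..\<tau>}" "k \<in> U" "k' \<in> U" for k k'
    using that unfolding orthonormal_pilots_def by (metis PiE zero_neq_one)
  \<comment> \<open>An AP \<open>m\<close> linking \<open>k\<close> to \<open>k'\<close> is exactly
    a common element of \<open>Uc k\<close> and \<open>Uc k'\<close>.\<close>
  have dual: "(\<forall>m\<in>Uc k. \<forall>k'\<in>Ac m. Q k') \<longleftrightarrow> (\<forall>k'\<in>U. Uc k \<inter> Uc k' \<noteq> {} \<longrightarrow> Q k')" for k Q
    unfolding Uc_def Ac_def ue_cluster_def ap_cluster_def by auto
  have "(\<forall>k\<in>U. \<forall>m\<in>Uc k. \<forall>k'\<in>Ac m. k' \<noteq> k \<longrightarrow> P k k') \<longleftrightarrow>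
    (\<forall>k\<in>U. \<forall>k'\<in>U. {k, k'} \<in> conflict_edges U Uc \<longrightarrow> P k k')" for P
    unfolding doubleton_in_conflict_edges_iff dual by metis
  then have "pilot_feasible U Uc Ac \<tau> \<phi> l \<longleftrightarrow>
    0 < \<tau> \<and> orthonormal_pilots \<tau> \<phi> \<and> l \<in> U \<rightarrow> {1..\<tau>} \<and>
    (\<forall>k\<in>U. \<forall>k'\<in>U. {k, k'} \<in> conflict_edges U Uc \<longrightarrow> \<phi> (l k) \<bullet>c \<phi> (l k') = 0)"
    unfolding pilot_feasible_def by simp
  \<comment> \<open>The equivalence \<open>orth\<close> needs orthonormality and the range of
    \<open>l\<close>; the congruence rules provide both from the earlier conjuncts.\<close>
  also have "\<dots> \<longleftrightarrow>
    0 < \<tau> \<and> orthonormal_pilots \<tau> \<phi> \<and> coloring_feasible U (conflict_edges U Uc) {1..\<tau>} l"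
    unfolding coloring_feasible_def using orth by (simp cong: conj_cong ball_cong)
  finally show ?thesis .
qed

text \<open>The two existence claims ensure that each \<open>LEAST\<close> is an attained minimum.
  An infinite color type offers color sets of every finite size.\<close>

theorem proposition1:
  fixes U :: "'u set" and A :: "'a set"
    and u :: "'u \<Rightarrow> real^2" and a :: "'a \<Rightarrow> real^2"
    and N Ep N0 gmin d0 PL r :: real
    and Uc :: "'u \<Rightarrow> 'a set" and Ac :: "'a \<Rightarrow> 'u set" and E :: "'u set set"
  assumes "finite U" "U \<noteq> {}" "finite A"
    and "N > 0" "Ep > 0" "N0 > 0" "gmin > 0" "d0 > 0" "PL > 0"
    and "r = cluster_radius U A u a (snr_distance N Ep N0 gmin d0 PL)"
    and "Uc = ue_cluster A u a r" and "Ac = ap_cluster U u a r"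
    and "E = conflict_edges U Uc"
    and "infinite (UNIV :: 'c set)"
  shows "(\<forall>\<tau> \<phi> l (C :: 'c set) \<sigma>.
            0 < \<tau> \<longrightarrow> orthonormal_pilots \<tau> \<phi> \<longrightarrow> l \<in> U \<rightarrow> {1..\<tau>} \<longrightarrow>
            bij_betw \<sigma> (\<phi> ` {1..\<tau>}) C \<longrightarrow>
            (pilot_feasible U Uc Ac \<tau> \<phi> l \<longleftrightarrow>
             coloring_feasible U E C (\<lambda>k. \<sigma> (\<phi> (l k)))))
       \<and> (\<exists>\<tau> \<phi> l. pilot_feasible U Uc Ac \<tau> \<phi> l)
       \<and> (\<exists>(C :: 'c set) c. coloring_feasible U E C c)
       \<and> (LEAST \<tau>. \<exists>\<phi> l. pilot_feasible U Uc Ac \<tau> \<phi> l)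
         = (LEAST n. \<exists>(C :: 'c set) c. coloring_feasible U E C c \<and> card C = n)"
proof -
  note pilot_iff = pilot_feasible_iff_coloring_feasible[of U A u a r, folded assms(11,12), folded assms(13)]
  have corr: "pilot_feasible U Uc Ac \<tau> \<phi> l \<longleftrightarrow> coloring_feasible U E C (\<lambda>k. \<sigma> (\<phi> (l k)))"
    if "0 < \<tau>" "orthonormal_pilots \<tau> \<phi>" "l \<in> U \<rightarrow> {1..\<tau>}" "bij_betw \<sigma> (\<phi> ` {1..\<tau>}) C"
    for \<tau> \<phi> l \<sigma> and C :: "'c set"
  proof -
    \<comment> \<open>The composite sends pilot indices directly to colors, so a single relabelling
      of \<open>{1..\<tau>}\<close> suffices.\<close>
    have "inj_on (\<sigma> \<circ> \<phi>) {1..\<tau>}" "(\<sigma> \<circ> \<phi>) ` {1..\<tau>} = C"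
      using that orthonormal_pilots_inj_on by (auto simp: bij_betw_def comp_inj_on image_comp)
    then show ?thesis
      using that coloring_feasible_inj_image_iff[of "\<sigma> \<circ> \<phi>" "{1..\<tau>}" l U E]
      by (simp add: pilot_iff)
  qed
  \<comment> \<open>All attainable values agree, not just the minima, so the two
    \<open>LEAST\<close> terms coincide by rewriting.\<close>
  have same_values: "(\<exists>\<phi> l. pilot_feasible U Uc Ac n \<phi> l) \<longleftrightarrow>
    (\<exists>(C :: 'c set) c. coloring_feasible U E C c \<and> card C = n)" for n
  proof
    assume "\<exists>\<phi> l. pilot_feasible U Uc Ac n \<phi> l"
    then obtain l where l: "coloring_feasible U E {1..n} l" by (auto simp: pilot_iff)
    obtain C :: "'c set" where C: "finite C" "card C = n"
      using infinite_arbitrarily_large[OF assms(14)] by blast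
    then show "\<exists>(C :: 'c set) c. coloring_feasible U E C c \<and> card C = n"
      using coloring_feasible_change_colors[OF l C(1)] by auto
  next
    assume "\<exists>(C :: 'c set) c. coloring_feasible U E C c \<and> card C = n"
    then obtain C :: "'c set" and c where c: "coloring_feasible U E C c" "card C = n" by blast
    \<comment> \<open>Some UE exists and needs a color; with no UE, zero colors would do while pilot
      lengths stay positive.\<close>
    then have "0 < n" using assms(2) unfolding coloring_feasible_def by (auto simp: card_gt_0_iff)
    then show "\<exists>\<phi> l. pilot_feasible U Uc Ac n \<phi> l"
      using coloring_feasible_change_colors[OF c(1), of "{1..n}"] c(2)
        orthonormal_pilots_unit_vec[of n] by (auto simp: pilot_iff)
  qed
  obtain C :: "'c set" where C: "finite C" "card C = card U"
    using infinite_arbitrarily_large[OF assms(14)] by blast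
  have coloring: "\<exists>(C :: 'c set) c. coloring_feasible U E C c"
    using coloring_feasible_change_colors[OF coloring_feasible_conflict_edges_id C, OF assms(1)] assms(13)
    by blast
  then have "\<exists>\<tau> \<phi> l. pilot_feasible U Uc Ac \<tau> \<phi> l" using same_values by blast
  with corr coloring show ?thesis by (simp add: same_values)
qed

end
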